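(* Let $\alpha>-1$ and let $n\ge1$ be an integer. The recurrence coefficient $\beta_n=\beta_n(t)$ satisfies, for $t\in\mathbb{R}$, the following second-order nonlinear ordinary differential equation (prime denoting $d/dt$): $$\begin{aligned}&\Big\{8t^2(t\beta_n'+\beta_n)(t\beta_n''+2\beta_n')+4t(2t-2n+1-2\alpha+4t\beta_n)(t\beta_n'+\beta_n)^2\\&\quad-4t(t\beta_n'+\beta_n)\left[2n\alpha+2(n-2\alpha)(n-2t\beta_n)-3(n-2t\beta_n)^2\right]+4(n-2t\beta_n)^4-4(n-3\alpha+t)(n-2t\beta_n)^3\\&\quad+4\left[n(t-3\alpha)-2\alpha(t-\alpha)\right](n-2t\beta_n)^2+8n\alpha(t-\alpha)(n-2t\beta_n)\Big\}^2\\&=\Big[2t(t\beta_n''+2\beta_n')+\big(2t-2\alpha+1-2(n-2t\beta_n)\big)(t\beta_n'+\beta_n)+3(n-2t\beta_n)^2-2(n-2\alpha)(n-2t\beta_n)-2n\alpha\Big]^2\\&\quad\times16t^2\left[\beta_n(n-2t\beta_n)(n+2\alpha-2t\beta_n)+(t\beta_n'+\beta_n)^2\right],\end{aligned}$$ with the initial conditions $$\beta_n(0)=\frac{n(n+2\alpha)}{(2n-1+2\alpha)(2n+1+2\alpha)},$$ $$\beta_n'(0)=\frac{4n(n+\alpha)(n+2\alpha)(1-4\alpha^2)}{(2n-1+2\alpha)^2(2n+1+2\alpha)^2(2n-3+2\alpha)(2n+3+2\alpha)},$$ where, for exceptional values of $\alpha$ at which such an expression is of the form $0/0$, it is understood as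 its limit in $\alpha$.
   Context: For $\alpha>-1$ and $t\in\mathbb{R}$ let $w(x,t)=(1-x^2)^{\alpha}e^{-tx^2}$, $x\in[-1,1]$. Let $P_n(x,t)$, $n=0,1,2,\ldots$, be the monic polynomials of degree $n$ orthogonal with respect to $w$: $\int_{-1}^1P_m(x,t)P_n(x,t)w(x,t)\,dx=h_n(t)\delta_{mn}$. Since $w$ is even they satisfy $xP_n(x,t)=P_{n+1}(x,t)+\beta_n(t)P_{n-1}(x,t)$ with $P_0=1$, $P_{-1}=0$; for $n\ge1$, $\beta_n(t)=h_n(t)/h_{n-1}(t)$. *)

theory Defs
  imports "HOL-Analysis.Analysis"
begin

(* At the endpoints x = 1, -1 the value 0 powr \<alpha> is 0 also for \<alpha> \<le> 0; they form a null set
   and do not affect the integrals below. *)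
definition weight :: "real \<Rightarrow> real \<Rightarrow> real \<Rightarrow> real" where
  "weight \<alpha> t x = (1 - x\<^sup>2) powr \<alpha> * exp (- (t * x\<^sup>2))"

definition weight_inner :: "real \<Rightarrow> real \<Rightarrow> real poly \<Rightarrow> real poly \<Rightarrow> real" where
  "weight_inner \<alpha> t p q = (LBINT x:{-1..1}. poly p x * poly q x * weight \<alpha> t x)"

definition monic_orthogonal_seq :: "real \<Rightarrow> real \<Rightarrow> (nat \<Rightarrow> real poly) \<Rightarrow> bool" where
  "monic_orthogonal_seq \<alpha> t P \<longleftrightarrow>
     (\<forall>n. degree (P n) = n \<and> lead_coeff (P n) = 1) \<and>
     (\<forall>m n. m \<noteq> n \<longrightarrow> weight_inner \<alpha> t (P m) (P n) = 0)"

(* For \<alpha> > -1 all moments are finite and the form weight_inner is positive definite, so this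
   sequence exists and is unique. *)
definition orth_poly :: "real \<Rightarrow> nat \<Rightarrow> real \<Rightarrow> real poly" where
  "orth_poly \<alpha> n t = (THE P. monic_orthogonal_seq \<alpha> t P) n"

(* The coefficient in x P_n = P_{n+1} + \<beta>_n P_{n-1}, to be used for n \<ge> 1 only
   (for n = 0 the subtraction n - 1 is truncated). *)
definition rec_coeff :: "real \<Rightarrow> nat \<Rightarrow> real \<Rightarrow> real" where
  "rec_coeff \<alpha> n t = (THE b. \<forall>x. x * poly (orth_poly \<alpha> n t) x =
     poly (orth_poly \<alpha> (n + 1) t) x + b * poly (orth_poly \<alpha> (n - 1) t) x)"

(* v is the value of the quotient num / den at a, read as its limit at a when the denominator
   vanishes there; the limit exists only if the numerator vanishes there too. *)
definition quotient_value :: "(real \<Rightarrow> real) \<Rightarrow> (real \<Rightarrow> real) \<Rightarrow> real \<Rightarrow> real \<Rightarrow> bool" where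
  "quotient_value num den a v \<longleftrightarrow>
     (if den a \<noteq> 0 then v = num a / den a else ((\<lambda>s. num s / den s) \<longlongrightarrow> v) (at a))"

end

theory Submission
  imports Defs
begin

text \<open>
  Write \<open>\<beta>\<^sub>n\<close> for the recurrence coefficients. They satisfy one equation in \<open>t\<close> and one in \<open>n\<close>.

  In \<open>t\<close>: since the weight satisfies \<open>\<partial>w/\<partial>t = - x\<^sup>2 w\<close>, the squared norms have logarithmic derivative
  \<open>- (\<beta>\<^sub>n\<^sub>+\<^sub>1 + \<beta>\<^sub>n)\<close>, and their quotients obey the Volterra lattice
  \<open>\<beta>\<^sub>n' = \<beta>\<^sub>n (\<beta>\<^sub>n\<^sub>-\<^sub>1 - \<beta>\<^sub>n\<^sub>+\<^sub>1)\<close> (lemma \<open>volterra\<close>).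

  In \<open>n\<close>: integrating the derivative of \<open>(1 - x\<^sup>2) w P\<^sub>n P\<^sub>n\<^sub>-\<^sub>1\<close> over the interval gives
  \<open>\<beta>\<^sub>n (2n + 1 + 2\<alpha> + 2t - 2t (\<beta>\<^sub>n\<^sub>+\<^sub>1 + \<beta>\<^sub>n + \<beta>\<^sub>n\<^sub>-\<^sub>1)) = n - 2 (\<beta>\<^sub>1 + \<dots> + \<beta>\<^sub>n\<^sub>-\<^sub>1)\<close>
  (lemma \<open>string_equation\<close>). Taking differences in \<open>n\<close> removes the sum, and the resulting third-order
  difference equation has the first integral
  \<open>\<beta>\<^sub>n f g = (n - 2t\<beta>\<^sub>n) (n + 2\<alpha> - 2t\<beta>\<^sub>n)\<close> with \<open>f = 2n + 1 + 2\<alpha> - 2t (\<beta>\<^sub>n\<^sub>+\<^sub>1 + \<beta>\<^sub>n)\<close> and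
  \<open>g = 2n - 1 + 2\<alpha> - 2t (\<beta>\<^sub>n + \<beta>\<^sub>n\<^sub>-\<^sub>1)\<close> (lemma \<open>first_integral\<close>).

  The differential equation is an elimination from these facts. Write \<open>\<beta>\<close> for \<open>\<beta>\<^sub>n\<close>, \<open>p = (f + g)/2\<close> and
  \<open>q = (f - g)/2\<close>. The lattice equation says \<open>t\<beta>' + \<beta> = \<beta>q\<close>, so by the first integral
  \<open>\<beta> (n - 2t\<beta>) (n + 2\<alpha> - 2t\<beta>) + (t\<beta>' + \<beta>)\<^sup>2 = (\<beta>p)\<^sup>2\<close>. The differenced string equations at \<open>n\<close> and
  \<open>n - 1\<close> express \<open>t (t\<beta>'' + 2\<beta>')\<close> as a polynomial in \<open>t, \<beta>, p, q\<close>. If \<open>X\<close> and \<open>Y\<close> are the expressions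
  whose squares appear on the two sides of the equation, then \<open>X + 4t\<beta>p Y\<close> is a multiple of
  \<open>\<beta>fg - (n - 2t\<beta>) (n + 2\<alpha> - 2t\<beta>)\<close> (lemma \<open>ode_factorisation\<close>), hence zero. Squaring
  \<open>X = - 4t\<beta>p Y\<close> removes the last quantity, \<open>p\<close>, that is not a function of \<open>\<beta>\<close> and its derivatives.

  At \<open>t = 0\<close> the string equation is a linear recursion for the partial sums of the \<open>\<beta>\<^sub>j\<close>, which is
  solved in closed form; the lattice equation then gives \<open>\<beta>\<^sub>n'(0)\<close>.
\<close>

section \<open>Monic orthogonal polynomials of an even positive functional\<close>

text \<open>A constant of its own for the indeterminate keeps the simplifier from turning products with
  it into \<open>pCons\<close> terms, so that polynomial identities stay within ring arithmetic.\<close>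
definition indet :: "real poly" where "indet = [:0, 1:]"

lemma poly_indet [simp]: "poly indet x = x"
  by (simp add: indet_def)

lemma coeff_indet_mult: "coeff (indet * p) k = (case k of 0 \<Rightarrow> 0 | Suc i \<Rightarrow> coeff p i)"
  by (simp add: indet_def coeff_pCons)

lemma coeff_indet_mult_Suc [simp]: "coeff (indet * p) (Suc k) = coeff p k"
  by (simp add: coeff_indet_mult)

fun monic_op :: "(real poly \<Rightarrow> real) \<Rightarrow> nat \<Rightarrow> real poly" where
  "monic_op L 0 = 1"
| "monic_op L (Suc 0) = indet"
| "monic_op L (Suc (Suc n)) = indet * monic_op L (Suc n) -
     smult (L (monic_op L (Suc n) * monic_op L (Suc n)) / L (monic_op L n * monic_op L n)) (monic_op L n)"

definition op_norm :: "(real poly \<Rightarrow> real) \<Rightarrow> nat \<Rightarrow> real" where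
  "op_norm L n = L (monic_op L n * monic_op L n)"

text \<open>The value \<open>0\<close> at \<open>n = 0\<close> makes the three-term recurrence hold for all \<open>n\<close>, although
  \<open>n - 1\<close> is truncated there.\<close>
definition op_coeff :: "(real poly \<Rightarrow> real) \<Rightarrow> nat \<Rightarrow> real" where
  "op_coeff L n = (if n = 0 then 0 else op_norm L n / op_norm L (n - 1))"

lemma op_coeff_0 [simp]: "op_coeff L 0 = 0"
  by (simp add: op_coeff_def)

lemma monic_op_recurrence:
  "indet * monic_op L n = monic_op L (Suc n) + smult (op_coeff L n) (monic_op L (n - 1))"
  by (cases n) (simp_all add: op_coeff_def op_norm_def)

lemma coeff_monic_op_above: "n < k \<Longrightarrow> coeff (monic_op L n) k = 0"
proof (induction L n arbitrary: k rule: monic_op.induct)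
  case (3 L n)
  then obtain i where "k = Suc i" by (cases k) auto
  with 3 show ?case by simp
qed (auto simp: indet_def coeff_pCons split: nat.splits)

lemma coeff_monic_op_lead: "coeff (monic_op L n) n = 1"
proof (induction L n rule: monic_op.induct)
  case (3 L n)
  then show ?case by (simp add: coeff_monic_op_above)
qed (auto simp: indet_def)

lemma degree_monic_op: "degree (monic_op L n) = n"
  by (metis coeff_monic_op_above coeff_monic_op_lead degree_le le_degree le_antisym zero_neq_one)

lemma monic_op_nonzero: "monic_op L n \<noteq> 0"
  by (metis coeff_0 coeff_monic_op_lead zero_neq_one)

lemma monic_op_parity: "poly (monic_op L n) (- x) = (-1) ^ n * poly (monic_op L n) x"
  by (induction L n rule: monic_op.induct) (auto simp: algebra_simps)

declare monic_op.simps(3) [simp del]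

text \<open>What is used of the integral against an even positive weight. The conclusion of \<open>L_odd\<close> holds by the
  reflection \<open>x \<mapsto> - x\<close>; it is the reason why the recurrence has no diagonal term.\<close>
locale moment_functional =
  fixes L :: "real poly \<Rightarrow> real"
  assumes L_add: "L (p + q) = L p + L q"
    and L_smult: "L (smult c p) = c * L p"
    and L_odd: "(\<And>x. poly p (- x) = - poly p x) \<Longrightarrow> L p = 0"
    and L_pos: "p \<noteq> 0 \<Longrightarrow> L (p * p) > 0"
begin

abbreviation P where "P \<equiv> monic_op L"
abbreviation h where "h \<equiv> op_norm L"
abbreviation b where "b \<equiv> op_coeff L"

lemma L_0: "L 0 = 0"
  using L_smult[of 0 0] by simp

lemma L_minus: "L (- p) = - L p"
  using L_smult[of "-1" p] by simp

lemma L_diff: "L (p - q) = L p - L q"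
  using L_add[of p "- q"] by (simp add: L_minus)

lemmas L_linear = L_add L_diff L_minus L_smult L_0

lemma h_pos: "h n > 0"
  by (simp add: op_norm_def L_pos monic_op_nonzero)

lemma h_Suc: "h (Suc n) = b (Suc n) * h n"
  using h_pos[of n] by (simp add: op_coeff_def)

lemma L_xPP: "L (indet * P n * P n) = 0"
  by (rule L_odd) (simp add: monic_op_parity algebra_simps flip: power_add mult_2)

text \<open>By the recurrence, \<open>L (P\<^sub>m P\<^sub>k\<^sub>+\<^sub>1) = L (x P\<^sub>m P\<^sub>k) - b\<^sub>k L (P\<^sub>m P\<^sub>k\<^sub>-\<^sub>1)\<close>. For \<open>m = k\<close> both terms vanish, the
  first by parity; for \<open>m < k\<close>, expanding \<open>x P\<^sub>m\<close> leaves a contribution only for \<open>m + 1 = k\<close>, and there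
  the choice of \<open>b\<^sub>k\<close> makes the terms cancel.\<close>
lemma orthogonal: "m < n \<Longrightarrow> L (P m * P n) = 0"
proof (induction n arbitrary: m rule: less_induct)
  case (less n)
  show ?case
  proof (cases n)
    case 0
    then show ?thesis using less by simp
  next
    case (Suc k)
    have "P n = indet * P k - smult (b k) (P (k - 1))"
      using monic_op_recurrence[of L k] Suc by simp
    then have rec: "P m * P n = (indet * P m) * P k - smult (b k) (P m * P (k - 1))"
      by (simp only: right_diff_distrib mult_smult_right mult_ac)
    have 1: "L (P i * P j) = (if i = j then h i else 0)" if "i \<le> k" "j \<le> k" for i j
      using less.IH[of i j] less.IH[of j i] that Suc
      by (cases i j rule: linorder_cases) (auto simp: op_norm_def mult.commute)
    have "m \<le> k" using less Suc by simp
    then consider "m = k" | "m < k" by linarith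
    then show ?thesis
    proof cases
      assume "m = k"
      then have "b k * L (P m * P (k - 1)) = 0"
        by (cases "k = 0") (auto simp: 1 op_coeff_def)
      with \<open>m = k\<close> show ?thesis
        unfolding rec by (simp add: L_linear L_xPP)
    next
      assume "m < k"
      have "L ((indet * P m) * P k) = L (P (Suc m) * P k) + b m * L (P (m - 1) * P k)"
        unfolding monic_op_recurrence by (simp add: algebra_simps L_linear)
      also have "\<dots> = (if Suc m = k then h k else 0)"
        using \<open>m < k\<close> by (auto simp: 1)
      also have "\<dots> = b k * L (P m * P (k - 1))"
        using \<open>m < k\<close> h_Suc[of "k - 1"] by (auto simp: 1)
      finally show ?thesis by (simp add: rec L_linear)
    qed
  qed
qed

lemma L_lower_degree: "\<lbrakk>\<And>k. N \<le> k \<Longrightarrow> coeff f k = 0; N \<le> m\<rbrakk> \<Longrightarrow> L (f * P m) = 0"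
proof (induction N arbitrary: f)
  case 0
  then have "f = 0" by (simp add: poly_eq_iff)
  then show ?case by (simp add: L_0)
next
  case (Suc N)
  define r where "r = f - smult (coeff f N) (P N)"
  have "coeff r k = 0" if "N \<le> k" for k
    using that Suc.prems by (cases "k = N") (auto simp: r_def coeff_monic_op_above coeff_monic_op_lead)
  then have "L (r * P m) = 0" using Suc by simp
  moreover have "f * P m = r * P m + smult (coeff f N) (P N * P m)"
    by (simp add: r_def algebra_simps)
  ultimately show ?case using Suc.prems by (simp add: L_linear orthogonal)
qed

text \<open>The form in which orthogonality is used to evaluate integrals below: subtracting the multiple of
  \<open>P\<^sub>m\<close> with the same coefficient leaves a polynomial of lower degree, which pairs to zero.\<close>
lemma L_lead_coeff:
  assumes "degree f \<le> m" shows "L (f * P m) = coeff f m * h m"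
proof -
  define r where "r = f - smult (coeff f m) (P m)"
  have "coeff r k = 0" if "m \<le> k" for k
    using that assms by (cases "k = m") (auto simp: r_def coeff_monic_op_above coeff_monic_op_lead coeff_eq_0)
  then have "L (r * P m) = 0" by (rule L_lower_degree) auto
  moreover have "f * P m = r * P m + smult (coeff f m) (P m * P m)"
    by (simp add: r_def algebra_simps)
  ultimately show ?thesis by (simp add: L_linear op_norm_def)
qed

lemma L_PP: "L (P m * P n) = (if m = n then h n else 0)"
  using orthogonal[of m n] orthogonal[of n m]
  by (cases m n rule: linorder_cases) (auto simp: op_norm_def mult.commute)

lemma L_x2PP: "L (indet\<^sup>2 * (P n * P n)) = h (Suc n) + b n * h n"
proof -
  have "indet\<^sup>2 * (P n * P n) = (indet * P n) * (indet * P n)"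
    by (simp add: power2_eq_square algebra_simps)
  then have "L (indet\<^sup>2 * (P n * P n)) = L (P (Suc n) * P (Suc n))
      + b n * L (P (Suc n) * P (n - 1)) + b n * L (P (n - 1) * P (Suc n)) + b n * (b n * L (P (n - 1) * P (n - 1)))"
    unfolding monic_op_recurrence
    by (simp only: ring_distribs mult_smult_left mult_smult_right L_linear)
  moreover have "b n * h (n - 1) = (if n = 0 then 0 else h n)"
    by (cases n) (simp_all add: h_Suc)
  ultimately show ?thesis by (auto simp: L_PP)
qed

lemma degree_pderiv_op: "degree (pderiv (P n)) = n - 1"
  by (simp add: degree_pderiv degree_monic_op)

lemma degree_indet [simp]: "degree indet = 1" by (simp add: indet_def)

lemma degree_indet_pow_pderiv:
  assumes "n > 0" shows "degree (indet ^ k * pderiv (P n)) = n + k - 1" "coeff (indet ^ k * pderiv (P n)) (n + k - 1) = n"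
proof -
  have c: "coeff (indet ^ k * p) (j + k) = coeff p j" for p j
    by (induction k) (auto simp: mult.assoc)
  obtain m where m: "n = Suc m" using assms by (cases n) auto
  show *: "coeff (indet ^ k * pderiv (P n)) (n + k - 1) = n"
    using c[of "pderiv (P n)" m] by (simp add: m coeff_pderiv coeff_monic_op_lead)
  have "degree (indet ^ k * pderiv (P n)) \<le> n + k - 1"
    using degree_mult_le[of "indet ^ k" "pderiv (P n)"] degree_power_le[of indet k] assms
    by (simp add: degree_pderiv_op)
  moreover have "degree (indet ^ k * pderiv (P n)) \<ge> n + k - 1"
    by (rule le_degree) (use * assms in simp)
  ultimately show "degree (indet ^ k * pderiv (P n)) = n + k - 1" by simp
qed

text \<open>The sum of the \<open>b\<^sub>j\<close> is, up to sign, the subleading coefficient of \<open>P\<^sub>n\<^sub>+\<^sub>1\<close>. Differentiating the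
  recurrence turns the left-hand side at \<open>n + 1\<close> into the one at \<open>n\<close> plus terms in which only a
  leading coefficient matters; so the sum arises by induction and no coefficient below the leading
  one has to be computed.\<close>
lemma L_x2_pderiv:
  "L (indet\<^sup>2 * pderiv (P (Suc n)) * P n) = ((real n + 1) * b (Suc n) + 2 * (\<Sum>j\<le>n. b j)) * h n"
proof (induction n)
  case 0
  have "L (indet\<^sup>2 * pderiv (P (Suc 0)) * P 0) = L (indet * P 0 * P 1)"
    by (simp add: power2_eq_square indet_def pderiv_pCons)
  then show ?case using h_Suc[of 0]
    by (simp add: monic_op_recurrence[of L 0, simplified] indet_def op_coeff_def op_norm_def)
next
  case (Suc n)
  let ?Q = "P (Suc n)" and ?b = "b (Suc n)"
  have drec: "pderiv (P (Suc (Suc n))) = ?Q + indet * pderiv ?Q - smult ?b (pderiv (P n))"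
    using arg_cong[OF monic_op_recurrence[of L "Suc n"], of pderiv]
    by (simp add: pderiv_mult pderiv_add pderiv_smult indet_def pderiv_pCons algebra_simps)
  have "indet\<^sup>2 * pderiv (P (Suc (Suc n))) * ?Q = indet\<^sup>2 * (?Q * ?Q)
     + indet\<^sup>2 * pderiv ?Q * (indet * ?Q) - smult ?b (indet\<^sup>2 * pderiv (P n) * ?Q)"
    unfolding drec by (simp add: algebra_simps)
  also have "indet\<^sup>2 * pderiv ?Q * (indet * ?Q) = indet\<^sup>2 * pderiv ?Q * P (Suc (Suc n))
      + smult ?b (indet\<^sup>2 * pderiv ?Q * P n)"
    unfolding monic_op_recurrence by (simp add: algebra_simps)
  finally have e: "L (indet\<^sup>2 * pderiv (P (Suc (Suc n))) * ?Q) = (h (Suc (Suc n)) + ?b * h (Suc n))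
    + L (indet\<^sup>2 * pderiv ?Q * P (Suc (Suc n))) + ?b * L (indet\<^sup>2 * pderiv ?Q * P n)
    - ?b * L (indet\<^sup>2 * pderiv (P n) * ?Q)"
    by (simp add: L_linear L_x2PP)
  have 1: "L (indet\<^sup>2 * pderiv ?Q * P (Suc (Suc n))) = (n + 1) * h (Suc (Suc n))"
    using L_lead_coeff[of "indet\<^sup>2 * pderiv ?Q" "Suc (Suc n)"] degree_indet_pow_pderiv[of "Suc n" 2]
    by simp
  have 2: "L (indet\<^sup>2 * pderiv (P n) * ?Q) = n * h (Suc n)"
    using L_lead_coeff[of "indet\<^sup>2 * pderiv (P n)" "Suc n"] degree_indet_pow_pderiv[of n 2]
    by (cases n) (simp_all add: L_0)
  show ?case
    unfolding e 1 2 Suc.IH by (simp add: h_Suc[of n] h_Suc[of "Suc n"] algebra_simps)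
qed

text \<open>Separates the coefficients of one factor from the functional, in preparation for
  differentiating with respect to a parameter on which both depend.\<close>
lemma L_mult_expand:
  assumes "degree p \<le> N"
  shows "L (p * q) = (\<Sum>k\<le>N. coeff p k * L (monom 1 k * q))"
proof -
  have L_sum: "L (\<Sum>k\<in>A. g k) = (\<Sum>k\<in>A. L (g k))" if "finite A" for A and g :: "nat \<Rightarrow> real poly"
    using that by (induction A) (auto simp: L_linear)
  have "p * q = (\<Sum>k\<le>N. smult (coeff p k) (monom 1 k * q))"
    using poly_as_sum_of_monoms'[OF assms] 
    by (metis (no_types, lifting) mult.right_neutral mult_smult_left smult_monom sum.cong sum_distrib_right)
  then show ?thesis by (simp add: L_sum L_linear)
qed

end

section \<open>The string equation and its first integral\<close>

text \<open>The additional assumption is the integrated Pearson equation: the integral of the derivative of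
  \<open>(1 - x\<^sup>2) w q\<close> vanishes.\<close>
locale deformed_jacobi_functional = moment_functional L for L +
  fixes \<alpha> t :: real
  assumes pearson: "L ((1 - indet\<^sup>2) * pderiv q - smult (2 * (\<alpha> + 1)) (indet * q)
    - smult (2 * t) (indet * (1 - indet\<^sup>2) * q)) = 0"
begin

text \<open>The Pearson identity for \<open>q = P\<^sub>n P\<^sub>n\<^sub>+\<^sub>1\<close>, each term being evaluated by orthogonality.\<close>
lemma string_equation_Suc:
  "b (Suc n) * (2 * real (Suc n) + 1 + 2 * \<alpha> + 2 * t - 2 * t * (b (Suc (Suc n)) + b (Suc n) + b n))
    = real (Suc n) - 2 * (\<Sum>j\<le>n. b j)"
proof -
  let ?Q = "P (Suc n)" and ?b = "b (Suc n)"
  have 1: "L (pderiv ?Q * P n) = (n + 1) * h n"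
    using L_lead_coeff[of "pderiv ?Q" "n"] degree_indet_pow_pderiv[of "Suc n" 0] by simp
  have 2: "L (pderiv (P n) * ?Q) = 0"
    using L_lead_coeff[of "pderiv (P n)" "Suc n"] by (simp add: degree_pderiv_op coeff_pderiv coeff_monic_op_above)
  have 3: "L (indet\<^sup>2 * pderiv (P n) * ?Q) = n * h (Suc n)"
    using L_lead_coeff[of "indet\<^sup>2 * pderiv (P n)" "Suc n"] degree_indet_pow_pderiv[of n 2]
    by (cases n) (simp_all add: L_0)
  have 4: "L (indet * P n * ?Q) = h (Suc n)"
    unfolding monic_op_recurrence by (simp add: algebra_simps L_linear L_PP)
  have "indet * (indet\<^sup>2 * (P n * ?Q)) = (indet * (indet * P n)) * (indet * ?Q)"
    by (simp add: power2_eq_square algebra_simps)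
  also have "indet * (indet * P n) = P (Suc (Suc n)) + smult (?b + b n) (P n) + smult (b n * b (n - 1)) (P (n - 2))"
  proof -
    have "indet * (indet * P n) = indet * P (Suc n) + smult (b n) (indet * P (n - 1))"
      unfolding monic_op_recurrence[of L n] by (simp add: algebra_simps)
    also have "smult (b n) (indet * P (n - 1)) = smult (b n) (P n + smult (b (n - 1)) (P (n - 2)))"
      unfolding monic_op_recurrence[of L "n - 1"]
      by (cases n) (simp_all add: op_coeff_def numeral_2_eq_2)
    also have "indet * P (Suc n) = P (Suc (Suc n)) + smult ?b (P n)"
      by (simp add: monic_op_recurrence)
    finally show ?thesis by (simp add: algebra_simps smult_add_left smult_add_right)
  qed
  also have "indet * ?Q = P (Suc (Suc n)) + smult ?b (P n)"
    by (simp add: monic_op_recurrence)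
  finally have e: "indet * (indet\<^sup>2 * (P n * ?Q)) = (P (Suc (Suc n)) + smult (?b + b n) (P n) + smult (b n * b (n - 1)) (P (n - 2)))
     * (P (Suc (Suc n)) + smult ?b (P n))" .
  have 0: "b n * b (n - 1) * L (P (n - 2) * P n) = 0"
    by (cases "n < 2") (auto simp: L_PP op_coeff_def less_2_cases_iff)
  have 5: "L (indet * (indet\<^sup>2 * (P n * ?Q))) = h (Suc n) * (b (Suc (Suc n)) + b (Suc n) + b n)"
    unfolding e using 0
    by (simp add: ring_distribs mult_smult_right mult_smult_left L_linear L_PP h_Suc[of n] h_Suc[of "Suc n"])
  have "(1 - indet\<^sup>2) * pderiv (P n * ?Q) - smult (2 * (\<alpha> + 1)) (indet * (P n * ?Q))
    - smult (2 * t) (indet * (1 - indet\<^sup>2) * (P n * ?Q))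
    = pderiv ?Q * P n - indet\<^sup>2 * pderiv ?Q * P n + pderiv (P n) * ?Q - indet\<^sup>2 * pderiv (P n) * ?Q
      - smult (2 * (\<alpha> + 1) + 2 * t) (indet * P n * ?Q) + smult (2 * t) (indet * (indet\<^sup>2 * (P n * ?Q)))"
    by (simp add: pderiv_mult algebra_simps smult_add_left smult_diff_right)
  then have "0 = (n + 1) * h n - ((real n + 1) * b (Suc n) + 2 * (\<Sum>j\<le>n. b j)) * h n - n * h (Suc n)
      - (2 * (\<alpha> + 1) + 2 * t) * h (Suc n) + 2 * t * (h (Suc n) * (b (Suc (Suc n)) + b (Suc n) + b n))"
    using pearson[of "P n * ?Q"]
    by (simp add: L_linear 1 2 3 4 5 L_x2_pderiv del: smult_add_left)
  also have "\<dots> = h n * (real (Suc n) - 2 * (\<Sum>j\<le>n. b j)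
    - b (Suc n) * (2 * real (Suc n) + 1 + 2 * \<alpha> + 2 * t - 2 * t * (b (Suc (Suc n)) + b (Suc n) + b n)))"
    unfolding h_Suc by (simp add: algebra_simps)
  finally show ?thesis using h_pos[of n] by simp
qed

lemma string_equation:
  "b n * (2 * real n + 1 + 2 * \<alpha> + 2 * t - 2 * t * (b (Suc n) + b n + b (n - 1)))
    = real n - 2 * (\<Sum>j<n. b j)"
  using string_equation_Suc[of "n - 1"]
  by (cases n) (simp_all add: op_coeff_def lessThan_Suc_atMost del: sum.lessThan_Suc)

text \<open>The difference of the two sides does not depend on \<open>n\<close>: the increments of the left and of the
  right side from \<open>n\<close> to \<open>n + 1\<close> are both
  \<open>(1 + 2t b\<^sub>n - 2t b\<^sub>n\<^sub>+\<^sub>1) (2n + 1 + 2\<alpha> - 2t (b\<^sub>n\<^sub>+\<^sub>1 + b\<^sub>n))\<close>, the left one by the differenced string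
  equation. At \<open>n = 0\<close> both sides vanish.\<close>
lemma first_integral:
  "b n * (2 * real n + 1 + 2 * \<alpha> - 2 * t * (b (Suc n) + b n)) * (2 * real n - 1 + 2 * \<alpha> - 2 * t * (b n + b (n - 1)))
    = (real n - 2 * t * b n) * (real n + 2 * \<alpha> - 2 * t * b n)"
proof (induction n)
  case 0
  then show ?case by (simp add: op_coeff_def)
next
  case (Suc n)
  have "b (Suc n) * (2 * real (Suc n) + 1 + 2 * \<alpha> + 2 * t - 2 * t * (b (Suc (Suc n)) + b (Suc n) + b n))
     = b n * (2 * real n + 1 + 2 * \<alpha> + 2 * t - 2 * t * (b (Suc n) + b n + b (n - 1))) + 1 - 2 * b n"
    using string_equation[of n] string_equation[of "Suc n"] by simp
  with Suc show ?case 
    by (simp add: algebra_simps) algebra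
qed

end

section \<open>Integration against the deformed Jacobi weight\<close>

definition weighted_integral :: "real \<Rightarrow> real \<Rightarrow> real poly \<Rightarrow> real" where
  "weighted_integral \<alpha> t p = (LBINT x:{-1..1}. poly p x * weight \<alpha> t x)"

lemma set_integrable_powr_unit:
  assumes "\<alpha> > -1"
  shows "set_integrable lborel {0..2} (\<lambda>x::real. x powr \<alpha>)"
proof -
  have "(\<lambda>x::real. x powr \<alpha>) integrable_on {0..2}"
    using has_integral_powr_from_0[OF assms, of 2] by (auto simp: integrable_on_def)
  then have "set_integrable lebesgue {0..2} (\<lambda>x::real. x powr \<alpha>)"
    by (intro nonnegative_absolutely_integrable_1) auto
  then show ?thesis
    unfolding set_integrable_def by (subst (asm) integrable_completion) auto
qed

text \<open>For negative \<open>\<alpha>\<close> each endpoint singularity is dominated by that of \<open>(1 - x) powr \<alpha>\<close> or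
  \<open>(1 + x) powr \<alpha>\<close>, because \<open>1 - x\<^sup>2 \<ge> 1 - \<bar>x\<bar>\<close>; for the other \<open>\<alpha>\<close> the factor is at most \<open>1\<close>.\<close>
lemma set_integrable_jacobi_factor:
  assumes "\<alpha> > -1"
  shows "set_integrable lborel {-1..1} (\<lambda>x::real. (1 - x\<^sup>2) powr \<alpha>)"
proof -
  have side: "set_integrable lborel {-1..1} (\<lambda>x::real. (1 + c * x) powr \<alpha>)" if "c \<in> {-1, 1}" for c
  proof -
    have "integrable lborel (\<lambda>x::real. indicator {0..2} (1 + c * x) *\<^sub>R (1 + c * x) powr \<alpha>)"
      using that lborel_integrable_real_affine[of "\<lambda>x::real. indicator {0..2} x *\<^sub>R x powr \<alpha>" c 1]
        set_integrable_powr_unit[OF assms] by (auto simp: set_integrable_def)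
    moreover have "indicator {0..2} (1 + c * x) = (indicator {-1..1} x :: real)" for x
      using that by (auto simp: indicator_def)
    ultimately show ?thesis by (simp add: set_integrable_def)
  qed
  have maj: "set_integrable lborel {-1..1} (\<lambda>x::real. 1 + ((1 + (-1) * x) powr \<alpha> + (1 + 1 * x) powr \<alpha>))"
    by (intro set_integral_add side) (auto simp: set_integrable_def)
  show ?thesis
  proof (rule set_integrable_bound[OF maj])
    show "set_borel_measurable lborel {-1..1} (\<lambda>x::real. (1 - x\<^sup>2) powr \<alpha>)"
      unfolding set_borel_measurable_def by measurable
    have "(1 - x\<^sup>2) powr \<alpha> \<le> 1 + ((1 - x) powr \<alpha> + (1 + x) powr \<alpha>)" if "x \<in> {-1..1}" for x :: real
    proof (cases "\<alpha> \<ge> 0 \<or> \<bar>x\<bar> = 1")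
      case True
      have sq: "x\<^sup>2 \<le> 1" using that by (simp add: abs_square_le_1 abs_le_iff)
      have "(1 - x\<^sup>2) powr \<alpha> \<le> 1"
      proof (cases "\<bar>x\<bar> = 1")
        case True then show ?thesis by (auto simp: abs_if power2_eq_square split: if_splits)
      next
        case False
        then show ?thesis using True sq powr_mono2[of \<alpha> "1 - x\<^sup>2" 1] by simp
      qed
      then show ?thesis by (smt (verit) powr_ge_zero)
    next
      case False
      then have ax: "\<bar>x\<bar> < 1" and a: "\<alpha> < 0" using that by auto
      have "x * x \<le> \<bar>x\<bar>" using ax mult_left_le[of "\<bar>x\<bar>" "\<bar>x\<bar>"] by simp
      then have "1 - \<bar>x\<bar> \<le> 1 - x\<^sup>2" by (simp add: power2_eq_square)
      then have "(1 - x\<^sup>2) powr \<alpha> \<le> (1 - \<bar>x\<bar>) powr \<alpha>"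
        using ax a by (intro powr_mono2') auto
      also have "\<dots> \<le> 1 + ((1 - x) powr \<alpha> + (1 + x) powr \<alpha>)"
        by (cases "x \<ge> 0") (auto simp: add_nonneg_nonneg)
      finally show ?thesis .
    qed
    then show "AE x in lborel. x \<in> {-1..1} \<longrightarrow>
        norm ((1 - x\<^sup>2) powr \<alpha>) \<le> norm (1 + ((1 + (-1) * x) powr \<alpha> + (1 + 1 * x) powr \<alpha>))"
      by (intro AE_I2 impI) (fastforce simp: add_nonneg_nonneg)
  qed
qed

lemma set_integrable_times_jacobi_factor:
  fixes g :: "real \<Rightarrow> real"
  assumes "\<alpha> > -1" and g: "continuous_on UNIV g"
  shows "set_integrable lborel {-1..1} (\<lambda>x. g x * (1 - x\<^sup>2) powr \<alpha>)"
proof -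
  have "bounded (g ` {-1..1})"
    by (intro compact_imp_bounded compact_continuous_image continuous_on_subset[OF g]) auto
  then obtain C where "\<forall>y \<in> g ` {-1..1}. norm y \<le> C"
    unfolding bounded_iff by blast
  then have C: "\<bar>g x\<bar> \<le> C" if "x \<in> {-1..1}" for x using that by auto
  show ?thesis
  proof (rule set_integrable_bound)
    show "set_integrable lborel {-1..1} (\<lambda>x::real. C * (1 - x\<^sup>2) powr \<alpha>)"
      by (intro set_integrable_mult_right set_integrable_jacobi_factor assms)
    have [measurable]: "g \<in> borel_measurable borel" using g by (rule borel_measurable_continuous_onI)
    show "set_borel_measurable lborel {-1..1} (\<lambda>x. g x * (1 - x\<^sup>2) powr \<alpha>)"
      unfolding set_borel_measurable_def by measurable
    show "AE x in lborel. x \<in> {-1..1} \<longrightarrow>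
        norm (g x * (1 - x\<^sup>2) powr \<alpha>) \<le> norm (C * (1 - x\<^sup>2) powr \<alpha>)"
      using C by (intro AE_I2 impI) (fastforce simp: abs_mult intro: mult_right_mono)
  qed
qed

lemma set_integrable_poly_weight:
  assumes "\<alpha> > -1"
  shows "set_integrable lborel {-1..1} (\<lambda>x. poly p x * weight \<alpha> t x)"
proof -
  have "set_integrable lborel {-1..1} (\<lambda>x. (poly p x * exp (- (t * x\<^sup>2))) * (1 - x\<^sup>2) powr \<alpha>)"
    by (rule set_integrable_times_jacobi_factor[OF assms]) (intro continuous_intros)
  then show ?thesis by (simp add: weight_def mult_ac)
qed

lemma weighted_integral_add:
  "\<alpha> > -1 \<Longrightarrow> weighted_integral \<alpha> t (p + q) = weighted_integral \<alpha> t p + weighted_integral \<alpha> t q"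
  by (simp add: weighted_integral_def distrib_right set_integrable_poly_weight)

lemma weighted_integral_smult: "weighted_integral \<alpha> t (smult c p) = c * weighted_integral \<alpha> t p"
  by (simp add: weighted_integral_def mult.assoc)

lemma weighted_integral_odd:
  assumes "\<And>x. poly p (- x) = - poly p x"
  shows "weighted_integral \<alpha> t p = 0"
proof -
  have "weighted_integral \<alpha> t p
      = (LBINT x. indicator {-1..1} (0 + (-1) * x) *\<^sub>R (poly p (0 + (-1) * x) * weight \<alpha> t (0 + (-1) * x)))"
    unfolding weighted_integral_def set_lebesgue_integral_def
    by (subst lborel_integral_real_affine[where c = "-1" and t = 0]) auto
  also have "\<dots> = (LBINT x. - (indicator {-1..1} x *\<^sub>R (poly p x * weight \<alpha> t x)))"
    by (intro Bochner_Integration.integral_cong refl) (auto simp: indicator_def assms weight_def)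
  also have "\<dots> = - weighted_integral \<alpha> t p"
    unfolding weighted_integral_def set_lebesgue_integral_def by (rule integral_minus)
  finally show ?thesis by simp
qed

text \<open>The integrand is nonnegative and vanishes in the open interval only at the roots of \<open>p\<close>, which
  form a null set.\<close>
lemma weighted_integral_pos:
  assumes "\<alpha> > -1" "p \<noteq> 0"
  shows "weighted_integral \<alpha> t (p * p) > 0"
proof -
  let ?f = "\<lambda>x. indicator {-1..1} x *\<^sub>R (poly (p * p) x * weight \<alpha> t x)"
  have nonneg: "0 \<le> ?f x" for x
    by (auto simp: weight_def indicator_def)
  have int: "integrable lborel ?f"
    using set_integrable_poly_weight[OF assms(1), of "p * p" t] by (simp add: set_integrable_def)
  have "integral\<^sup>L lborel ?f \<noteq> 0"
  proof
    assume "integral\<^sup>L lborel ?f = 0"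
    then have "AE x in lborel. ?f x = 0"
      using integral_nonneg_eq_0_iff_AE[OF int] nonneg by auto
    moreover have "AE x in lborel. x \<notin> {x. poly p x = 0}"
      by (intro AE_not_in countable_imp_null_set_lborel countable_finite poly_roots_finite assms)
    ultimately have "AE x in lborel. x \<notin> {-1<..<1::real}"
    proof eventually_elim
      case (elim x)
      then show ?case
        by (auto simp: weight_def power2_eq_1_iff abs_square_eq_1)
    qed
    then have "{-1<..<1::real} \<in> null_sets lborel"
      by (subst AE_iff_null_sets) auto
    moreover have "emeasure lborel {-1<..<1::real} = 2"
      by (subst emeasure_lborel_Ioo) auto
    ultimately show False by (simp add: null_sets_def)
  qed
  moreover have "integral\<^sup>L lborel ?f \<ge> 0" using nonneg by (intro integral_nonneg_AE) auto
  ultimately show ?thesis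
    by (simp add: weighted_integral_def set_lebesgue_integral_def)
qed

text \<open>The integrand is the derivative of \<open>(1 - x\<^sup>2) powr (\<alpha> + 1) * exp (- t x\<^sup>2) * q(x)\<close>, which is continuous
  on the closed interval and vanishes at both endpoints since \<open>\<alpha> + 1 > 0\<close>.\<close>
lemma weighted_integral_pearson:
  assumes "\<alpha> > -1"
  shows "weighted_integral \<alpha> t ((1 - indet\<^sup>2) * pderiv q - smult (2 * (\<alpha> + 1)) (indet * q)
    - smult (2 * t) (indet * (1 - indet\<^sup>2) * q)) = 0" (is "weighted_integral \<alpha> t ?r = 0")
proof -
  let ?F = "\<lambda>x::real. (1 - x\<^sup>2) powr (\<alpha> + 1) * (exp (- (t * x\<^sup>2)) * poly q x)"
  have "((\<lambda>x. poly ?r x * weight \<alpha> t x) has_integral (?F 1 - ?F (-1))) {-1..1}"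
  proof (rule fundamental_theorem_of_calculus_interior)
    show "continuous_on {-1..1} ?F"
      using assms by (intro continuous_intros continuous_on_powr') (auto simp: abs_square_le_1 abs_le_iff)
    fix x :: real assume x: "x \<in> {-1<..<1}"
    then have pos: "1 - x\<^sup>2 > 0" by (simp add: abs_square_less_1 abs_less_iff)
    then have pw: "(1 - x\<^sup>2) powr (\<alpha> + 1) = (1 - x\<^sup>2) * (1 - x\<^sup>2) powr \<alpha>"
      by (simp add: powr_add)
    have 1: "((\<lambda>x. (1 - x\<^sup>2) powr (\<alpha> + 1)) has_real_derivative (\<alpha> + 1) * (1 - x\<^sup>2) powr \<alpha> * (- (2 * x))) (at x)"
      using pos by (auto intro!: derivative_eq_intros)
    have 2: "((\<lambda>x. exp (- (t * x\<^sup>2)) * poly q x) has_real_derivative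
        exp (- (t * x\<^sup>2)) * (poly (pderiv q) x - 2 * t * x * poly q x)) (at x)"
      by (auto intro!: derivative_eq_intros simp: algebra_simps)
    have "(?F has_real_derivative poly ?r x * weight \<alpha> t x) (at x)"
      by (rule DERIV_cong[OF DERIV_mult[OF 1 2]], unfold pw weight_def)
         (simp add: algebra_simps power2_eq_square)
    then show "(?F has_vector_derivative poly ?r x * weight \<alpha> t x) (at x)"
      by (simp add: has_real_derivative_iff_has_vector_derivative)
  qed simp
  then have "integral {-1..1} (\<lambda>x. poly ?r x * weight \<alpha> t x) = 0"
    by (simp add: integral_unique)
  then show ?thesis
    unfolding weighted_integral_def
    using set_borel_integral_eq_integral(2)[OF set_integrable_poly_weight[OF assms]] by metis
qed

lemma weighted_integral_deformed_jacobi: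
  assumes "\<alpha> > -1"
  shows "deformed_jacobi_functional (weighted_integral \<alpha> t) \<alpha> t"
proof
  show "weighted_integral \<alpha> t p = 0" if "\<And>x. poly p (- x) = - poly p x" for p
    using that by (rule weighted_integral_odd)
qed (rule weighted_integral_add weighted_integral_smult weighted_integral_pos
      weighted_integral_pearson assms | assumption)+

text \<open>Uniqueness: if \<open>Q\<^sub>m = P\<^sub>m\<close> for all \<open>m < n\<close>, then \<open>r = Q\<^sub>n - P\<^sub>n\<close> has degree \<open>d < n\<close> and is orthogonal
  to \<open>P\<^sub>d\<close>; but pairing with \<open>P\<^sub>d\<close> detects the leading coefficient of \<open>r\<close>.\<close>
lemma monic_orthogonal_seq_iff:
  assumes "\<alpha> > -1"
  shows "monic_orthogonal_seq \<alpha> t Q \<longleftrightarrow> Q = monic_op (weighted_integral \<alpha> t)"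
proof -
  interpret deformed_jacobi_functional "weighted_integral \<alpha> t" \<alpha> t
    by (rule weighted_integral_deformed_jacobi[OF assms])
  let ?L = "weighted_integral \<alpha> t"
  have inner: "weight_inner \<alpha> t p q = ?L (p * q)" for p q
    by (simp add: weight_inner_def weighted_integral_def)
  have "Q n = P n" if Q: "monic_orthogonal_seq \<alpha> t Q" for n
  proof (induction n rule: less_induct)
    case (less n)
    have deg: "degree (Q n) = n" "coeff (Q n) n = 1"
      using Q unfolding monic_orthogonal_seq_def by metis+
    define r where "r = Q n - P n"
    have "coeff r k = 0" if "n \<le> k" for k
      using that deg by (cases "k = n")
        (auto simp: r_def coeff_monic_op_above coeff_monic_op_lead coeff_eq_0)
    then have r_small: "r \<noteq> 0 \<Longrightarrow> degree r < n"
      by (metis leading_coeff_0_iff not_less)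
    have "r = 0"
    proof (rule ccontr)
      assume "r \<noteq> 0"
      with r_small have d: "degree r < n" by simp
      have "?L (Q n * Q (degree r)) = 0"
        using Q d by (auto simp: monic_orthogonal_seq_def inner)
      then have "?L (r * P (degree r)) = 0"
        using d less.IH[OF d] by (simp add: r_def left_diff_distrib L_linear L_PP)
      moreover have "?L (r * P (degree r)) = lead_coeff r * h (degree r)"
        by (rule L_lead_coeff) simp
      ultimately show False
        using \<open>r \<noteq> 0\<close> h_pos[of "degree r"] by simp
    qed
    then show ?case by (simp add: r_def)
  qed
  moreover have "monic_orthogonal_seq \<alpha> t P"
    by (auto simp: monic_orthogonal_seq_def inner degree_monic_op coeff_monic_op_lead L_PP)
  ultimately show ?thesis by auto
qed

lemma orth_poly_eq: "\<alpha> > -1 \<Longrightarrow> orth_poly \<alpha> n t = monic_op (weighted_integral \<alpha> t) n"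
  by (simp add: orth_poly_def monic_orthogonal_seq_iff)

lemma rec_coeff_eq:
  assumes "\<alpha> > -1"
  shows "rec_coeff \<alpha> n t = op_coeff (weighted_integral \<alpha> t) n"
proof -
  let ?L = "weighted_integral \<alpha> t"
  let ?p = "monic_op ?L (n - 1)"
  have rec: "x * poly (monic_op ?L n) x = poly (monic_op ?L (n + 1)) x + op_coeff ?L n * poly ?p x" for x
    using arg_cong[OF monic_op_recurrence[of ?L n], of "\<lambda>q. poly q x"] by simp
  show ?thesis
    unfolding rec_coeff_def orth_poly_eq[OF assms]
  proof (rule the_equality)
    fix c assume c: "\<forall>x. x * poly (monic_op ?L n) x = poly (monic_op ?L (n + 1)) x + c * poly ?p x"
    obtain x where "poly ?p x \<noteq> 0"
      using monic_op_nonzero[of ?L "n - 1"] poly_all_0_iff_0 by blast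
    then show "c = op_coeff ?L n" using c rec[of x] by auto
  qed (use rec in blast)
qed

section \<open>Dependence on the deformation parameter\<close>

lemma exp_remainder_le:
  fixes y :: real assumes "\<bar>y\<bar> \<le> 1" shows "\<bar>exp y - 1 - y\<bar> \<le> y\<^sup>2"
proof (cases "y \<ge> 0")
  case True
  then show ?thesis using assms exp_bound[of y] exp_ge_add_one_self[of y] by linarith
next
  case False
  have "exp y * (1 - y) \<le> exp y * exp (- y)"
    using exp_ge_add_one_self[of "- y"] by (intro mult_left_mono) auto
  then have "exp y * (1 - y) \<le> 1" by (simp flip: exp_add)
  moreover have "(1 + y + y\<^sup>2) * (1 - y) \<ge> 1" 
  proof -
    have "(1 + y + y\<^sup>2) * (1 - y) = 1 - y ^ 3" by (simp add: algebra_simps power2_eq_square power3_eq_cube)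
    then show ?thesis using False by simp
  qed
  ultimately have "exp y * (1 - y) \<le> (1 + y + y\<^sup>2) * (1 - y)" by linarith
  then have "exp y \<le> 1 + y + y\<^sup>2" using False by (simp add: mult_le_cancel_right)
  then show ?thesis using exp_ge_add_one_self[of y] by linarith
qed

text \<open>The weight is singular at the endpoints, so differentiation under the integral is done by hand:
  the second-order remainder of the exponential, with exponent increment \<open>y = - (s - t) x\<^sup>2\<close>, bounds the
  error by \<open>(s - t)\<^sup>2\<close> times an integrable function that does not depend on \<open>s\<close>.\<close>
lemma weighted_integral_DERIV:
  assumes "\<alpha> > -1"
  shows "((\<lambda>s. weighted_integral \<alpha> s p) has_real_derivative - weighted_integral \<alpha> t (indet\<^sup>2 * p)) (at t)"
proof -
  let ?D = "weighted_integral \<alpha> t (indet\<^sup>2 * p)"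
  define K where "K = (LBINT x:{-1..1}. \<bar>poly p x\<bar> * exp \<bar>t\<bar> * (1 - x\<^sup>2) powr \<alpha>)"
  have Kint: "set_integrable lborel {-1..1} (\<lambda>x. \<bar>poly p x\<bar> * exp \<bar>t\<bar> * (1 - x\<^sup>2) powr \<alpha>)"
    by (rule set_integrable_times_jacobi_factor[OF assms]) (intro continuous_intros)
  have bound: "\<bar>weighted_integral \<alpha> s p - weighted_integral \<alpha> t p + (s - t) * ?D\<bar> \<le> (s - t)\<^sup>2 * K"
    if "\<bar>s - t\<bar> \<le> 1" for s
  proof -
    let ?g = "\<lambda>x. poly p x * weight \<alpha> s x - poly p x * weight \<alpha> t x + (s - t) * (poly (indet\<^sup>2 * p) x * weight \<alpha> t x)"
    note I = set_integrable_poly_weight[OF assms]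
    have gi: "set_integrable lborel {-1..1} ?g"
      by (intro set_integral_add set_integral_diff set_integrable_mult_right I)
    have eq: "weighted_integral \<alpha> s p - weighted_integral \<alpha> t p + (s - t) * ?D = (LBINT x:{-1..1}. ?g x)"
      unfolding weighted_integral_def
      by (subst set_integral_add set_integral_diff set_integral_mult_right, (intro set_integral_diff set_integrable_mult_right I)+)+ simp
    have "\<bar>LBINT x:{-1..1}. ?g x\<bar> \<le> (LBINT x:{-1..1}. (s - t)\<^sup>2 * (\<bar>poly p x\<bar> * exp \<bar>t\<bar> * (1 - x\<^sup>2) powr \<alpha>))"
    proof -
      have "norm (?g x) \<le> (s - t)\<^sup>2 * (\<bar>poly p x\<bar> * exp \<bar>t\<bar> * (1 - x\<^sup>2) powr \<alpha>)" if x: "x \<in> {-1..1}" for x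
      proof -
        have x2: "0 \<le> x\<^sup>2" "x\<^sup>2 \<le> 1" using x by (auto simp: abs_square_le_1 abs_le_iff)
        define y where "y = - (s - t) * x\<^sup>2"
        have "\<bar>y\<bar> = \<bar>s - t\<bar> * x\<^sup>2" by (simp add: y_def abs_mult abs_minus_commute)
        then have "\<bar>y\<bar> \<le> \<bar>s - t\<bar>" using x2 by (simp add: mult_left_le)
        then have y: "\<bar>y\<bar> \<le> 1" "y\<^sup>2 \<le> (s - t)\<^sup>2"
          using \<open>\<bar>s - t\<bar> \<le> 1\<close> by (linarith, simp add: abs_le_square_iff)
        have "- (t * x\<^sup>2) \<le> \<bar>t\<bar> * x\<^sup>2" using x2 by (metis abs_ge_minus_self mult_minus_left mult_right_mono)
        also have "\<dots> \<le> \<bar>t\<bar>" using x2 by (simp add: mult_left_le)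
        finally have e: "exp (- (t * x\<^sup>2)) \<le> exp \<bar>t\<bar>" by simp
        have "exp (- (s * x\<^sup>2)) = exp (- (t * x\<^sup>2)) * exp y"
          by (simp add: y_def algebra_simps flip: exp_add)
        then have "?g x = (poly p x * (1 - x\<^sup>2) powr \<alpha>) * exp (- (t * x\<^sup>2)) * (exp y - 1 - y)"
          by (simp add: weight_def y_def algebra_simps power2_eq_square)
        then have "norm (?g x) = (\<bar>poly p x\<bar> * (1 - x\<^sup>2) powr \<alpha>) * (exp (- (t * x\<^sup>2)) * \<bar>exp y - 1 - y\<bar>)"
          by (simp add: abs_mult)
        also have "\<dots> \<le> (\<bar>poly p x\<bar> * (1 - x\<^sup>2) powr \<alpha>) * (exp \<bar>t\<bar> * (s - t)\<^sup>2)"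
          using exp_remainder_le[OF y(1)] y(2) e by (intro mult_left_mono mult_mono) auto
        finally show ?thesis by (simp add: mult_ac)
      qed
      moreover have "norm (LBINT x:{-1..1}. ?g x) \<le> (LBINT x:{-1..1}. norm (?g x))"
        by (rule set_integral_norm_bound[OF gi])
      moreover have "(LBINT x:{-1..1}. norm (?g x)) \<le> (LBINT x:{-1..1}. (s - t)\<^sup>2 * (\<bar>poly p x\<bar> * exp \<bar>t\<bar> * (1 - x\<^sup>2) powr \<alpha>))"
        by (intro set_integral_mono set_integrable_norm set_integrable_mult_right gi Kint calculation(1))
      ultimately show ?thesis by simp
    qed
    also have "\<dots> = (s - t)\<^sup>2 * K"
      unfolding K_def by (rule set_integral_mult_right)
    finally show ?thesis unfolding eq .
  qed
  have "((\<lambda>s. (weighted_integral \<alpha> s p - weighted_integral \<alpha> t p) / (s - t) - - ?D) \<longlongrightarrow> 0) (at t)"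
  proof (rule Lim_null_comparison)
    have "norm ((weighted_integral \<alpha> s p - weighted_integral \<alpha> t p) / (s - t) - - ?D) \<le> \<bar>s - t\<bar> * K"
      if "s \<noteq> t" "\<bar>s - t\<bar> \<le> 1" for s
    proof -
      have "(weighted_integral \<alpha> s p - weighted_integral \<alpha> t p) / (s - t) - - ?D
         = (weighted_integral \<alpha> s p - weighted_integral \<alpha> t p + (s - t) * ?D) / (s - t)"
        using that by (simp add: field_simps)
      moreover have "(s - t)\<^sup>2 * K = (\<bar>s - t\<bar> * K) * \<bar>s - t\<bar>"
        by (simp add: power2_eq_square)
      ultimately show ?thesis
        using bound[OF that(2)] that(1) by (simp only: real_norm_def abs_divide divide_le_eq) simp
    qed
    then show "\<forall>\<^sub>F s in at t. norm ((weighted_integral \<alpha> s p - weighted_integral \<alpha> t p) / (s - t) - - ?D) \<le> \<bar>s - t\<bar> * K"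
      unfolding eventually_at by (intro exI[of _ 1]) (auto simp: dist_real_def)
    show "((\<lambda>s. \<bar>s - t\<bar> * K) \<longlongrightarrow> 0) (at t)"
      by (auto intro!: tendsto_eq_intros)
  qed
  then show ?thesis unfolding has_field_derivative_iff by (rule LIM_zero_cancel)
qed

text \<open>The norm at \<open>s\<close> is the pairing of \<open>P\<^sub>n(\<cdot>, s)\<close> with the fixed monic polynomial \<open>P\<^sub>n(\<cdot>, t)\<close>. This avoids
  a product rule for two varying factors: at \<open>s = t\<close> the variation of the first factor has degree
  below \<open>n\<close> and pairs to zero with \<open>P\<^sub>n(\<cdot>, t)\<close>, so only the variation of the weight contributes.\<close>
lemma op_norm_DERIV:
  assumes \<alpha>: "\<alpha> > -1"
    and diff: "\<And>k. (\<lambda>s. coeff (monic_op (weighted_integral \<alpha> s) n) k) differentiable (at t)"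
  shows "((\<lambda>s. op_norm (weighted_integral \<alpha> s) n) has_real_derivative
    - (op_coeff (weighted_integral \<alpha> t) (Suc n) + op_coeff (weighted_integral \<alpha> t) n)
      * op_norm (weighted_integral \<alpha> t) n) (at t)"
proof -
  let ?L = "weighted_integral \<alpha>"
  define c where "c s k = coeff (monic_op (?L s) n) k" for s k
  define Q where "Q = monic_op (?L t) n"
  obtain c' where c': "\<And>k. ((\<lambda>s. c s k) has_real_derivative c' k) (at t)"
    using diff unfolding real_differentiable_def c_def by metis
  have lead: "c s n = 1" for s by (simp add: c_def coeff_monic_op_lead)
  then have "c' n = 0"
    using c'[of n] DERIV_unique[OF DERIV_const[of 1 "at t"]] by simp
  interpret t: deformed_jacobi_functional "?L t" \<alpha> t
    by (rule weighted_integral_deformed_jacobi[OF \<alpha>])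
  have norm_eq: "op_norm (?L s) n = (\<Sum>k\<le>n. c s k * ?L s (monom 1 k * Q))" for s
  proof -
    interpret s: deformed_jacobi_functional "?L s" \<alpha> s
      by (rule weighted_integral_deformed_jacobi[OF \<alpha>])
    have "op_norm (?L s) n = ?L s (Q * s.P n)"
      by (subst s.L_lead_coeff) (auto simp: Q_def degree_monic_op coeff_monic_op_lead)
    also have "\<dots> = ?L s (s.P n * Q)" by (simp add: mult.commute)
    also have "\<dots> = (\<Sum>k\<le>n. c s k * ?L s (monom 1 k * Q))"
      by (subst s.L_mult_expand[of _ n]) (auto simp: c_def degree_monic_op)
    finally show ?thesis .
  qed
  have "((\<lambda>s. \<Sum>k\<le>n. c s k * ?L s (monom 1 k * Q)) has_real_derivative
      (\<Sum>k\<le>n. c' k * ?L t (monom 1 k * Q) + (- ?L t (indet\<^sup>2 * (monom 1 k * Q))) * c t k)) (at t)"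
    by (intro DERIV_sum DERIV_mult c' weighted_integral_DERIV \<alpha>)
  also have "(\<Sum>k\<le>n. c' k * ?L t (monom 1 k * Q) + (- ?L t (indet\<^sup>2 * (monom 1 k * Q))) * c t k)
     = - (\<Sum>k\<le>n. c t k * ?L t (monom 1 k * (indet\<^sup>2 * Q)))"
  proof -
    have *: "c' k * ?L t (monom 1 k * Q) = 0" if "k \<le> n" for k
      using that \<open>c' n = 0\<close> t.L_lead_coeff[of "monom 1 k" n]
      by (cases "k = n") (auto simp: Q_def degree_monom_eq)
    show ?thesis
      unfolding sum_negf[symmetric]
    proof (intro sum.cong refl)
      fix k assume "k \<in> {..n}"
      then have "c' k * ?L t (monom 1 k * Q) = 0" using * by simp
      then show "c' k * ?L t (monom 1 k * Q) + (- ?L t (indet\<^sup>2 * (monom 1 k * Q))) * c t k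
          = - (c t k * ?L t (monom 1 k * (indet\<^sup>2 * Q)))"
        by (simp only:) (simp add: mult_ac)
    qed
  qed
  also have "(\<Sum>k\<le>n. c t k * ?L t (monom 1 k * (indet\<^sup>2 * Q))) = ?L t (indet\<^sup>2 * (Q * Q))"
    using t.L_mult_expand[of Q n "indet\<^sup>2 * Q"]
    by (simp add: c_def Q_def degree_monic_op mult_ac)
  also have "\<dots> = (t.b (Suc n) + t.b n) * t.h n"
    unfolding Q_def t.L_x2PP by (simp add: t.h_Suc algebra_simps)
  finally show ?thesis by (simp only: norm_eq[symmetric] mult_minus_left)
qed

text \<open>The recursion builds \<open>P\<^sub>n\<close> from earlier polynomials and quotients of their norms, and these norms
  are differentiable as soon as the coefficients of the earlier polynomials are.\<close>
lemma coeff_monic_op_differentiable: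
  assumes \<alpha>: "\<alpha> > -1"
  shows "(\<lambda>s. coeff (monic_op (weighted_integral \<alpha> s) n) k) differentiable (at t)"
proof (induction n arbitrary: k rule: less_induct)
  case (less n)
  consider "n = 0" | "n = 1" | m where "n = Suc (Suc m)"
    by (metis One_nat_def old.nat.exhaust)
  then show ?case
  proof cases
    case 3
    let ?h = "\<lambda>m s. op_norm (weighted_integral \<alpha> s) m"
    have h: "?h i differentiable (at t)" if "i < n" for i
      using op_norm_DERIV[OF \<alpha> less.IH] that unfolding real_differentiable_def by blast
    interpret deformed_jacobi_functional "weighted_integral \<alpha> t" \<alpha> t
      by (rule weighted_integral_deformed_jacobi[OF \<alpha>])
    have "(\<lambda>s. coeff (indet * monic_op (weighted_integral \<alpha> s) (Suc m)) k) differentiable (at t)"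
      using less.IH[of "Suc m"] 3 by (cases k) (auto simp: coeff_indet_mult)
    then show ?thesis
      unfolding 3 monic_op.simps(3) coeff_diff coeff_smult op_norm_def[symmetric]
      using h_pos[of m] 3
      by (intro differentiable_diff differentiable_mult differentiable_divide h less.IH) auto
  qed auto
qed

text \<open>Logarithmic differentiation of \<open>b\<^sub>n = h\<^sub>n / h\<^sub>n\<^sub>-\<^sub>1\<close>.\<close>
lemma volterra:
  assumes \<alpha>: "\<alpha> > -1"
  shows "((\<lambda>s. op_coeff (weighted_integral \<alpha> s) n) has_real_derivative
    op_coeff (weighted_integral \<alpha> t) n *
      (op_coeff (weighted_integral \<alpha> t) (n - 1) - op_coeff (weighted_integral \<alpha> t) (Suc n))) (at t)"
proof (cases n)
  case (Suc m)
  interpret deformed_jacobi_functional "weighted_integral \<alpha> t" \<alpha> t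
    by (rule weighted_integral_deformed_jacobi[OF \<alpha>])
  note D = op_norm_DERIV[OF \<alpha> coeff_monic_op_differentiable[OF \<alpha>]]
  have nz: "h m \<noteq> 0" using h_pos[of m] by simp
  show ?thesis
    unfolding Suc op_coeff_def[of _ "Suc m" for L]
    by (simp, rule DERIV_cong[OF DERIV_divide[OF D D nz]])
       (use nz in \<open>simp add: h_Suc field_simps\<close>)
qed simp

section \<open>Elimination of the neighbouring coefficients\<close>

text \<open>Here \<open>w\<close> stands for \<open>t\<beta>' + \<beta>\<close> and \<open>Z\<close> for \<open>t (t\<beta>'' + 2\<beta>')\<close>. The last factor on the right-hand side
  is the defect in the first integral.\<close>
lemma ode_factorisation:
  fixes t n \<alpha> b p q w Z N :: real
  assumes w: "w = b * q"
    and Z: "2 * Z = - 8 * t\<^sup>2 * b\<^sup>2 + 4 * t * (n + \<alpha>) * b - 4 * t * b\<^sup>2 * p - 2 * t * b * p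
      + 2 * (n + \<alpha>) * b * p - b * (p\<^sup>2 - q\<^sup>2) - b * q"
    and N: "N = n - 2 * t * b"
  shows "(8 * t * w * Z + 4 * t * (2 * t - 2 * n + 1 - 2 * \<alpha> + 4 * t * b) * w\<^sup>2
        - 4 * t * w * (2 * n * \<alpha> + 2 * (n - 2 * \<alpha>) * N - 3 * N\<^sup>2)
        + 4 * N ^ 4 - 4 * (n - 3 * \<alpha> + t) * N ^ 3
        + 4 * (n * (t - 3 * \<alpha>) - 2 * \<alpha> * (t - \<alpha>)) * N\<^sup>2 + 8 * n * \<alpha> * (t - \<alpha>) * N)
    + 4 * t * (b * p) * (2 * Z + (2 * t - 2 * \<alpha> + 1 - 2 * N) * w + 3 * N\<^sup>2 - 2 * (n - 2 * \<alpha>) * N - 2 * n * \<alpha>)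
    = - 4 * t * b * (4 * t * b + 2 * t - 2 * n - 2 * \<alpha> + p + q)
      * (b * ((p + q) * (p - q)) - N * (n + 2 * \<alpha> - 2 * t * b))"
proof -
  have "8 * t * w * Z = 4 * t * w * (2 * Z)" by simp
  then show ?thesis
    unfolding Z w N
    by (simp only:) (simp add: algebra_simps power2_eq_square power3_eq_cube power4_eq_xxxx)
qed

text \<open>With \<open>l2, l, b, u, u2\<close> for five consecutive recurrence coefficients, \<open>up\<close> and \<open>down\<close> are the differenced
  string equations; they determine \<open>t u u2\<close> and \<open>t l l2\<close>, the only places where \<open>u2\<close> and \<open>l2\<close> enter
  the second derivative.\<close>
lemma second_derivative_polynomial:
  fixes t b u l u2 l2 n \<alpha> b1 b2 p q :: real
  assumes p: "p = 2 * n + 2 * \<alpha> - t * (u + 2 * b + l)" and q: "q = 1 + t * (l - u)"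
    and b1: "b1 = b * (l - u)" 
    and b2: "b2 = b1 * (l - u) + b * (l * (l2 - b) - u * (b - u2))"
    and up: "u * (2 * (n + 1) + 1 + 2 * \<alpha> + 2 * t - 2 * t * (u2 + u + b))
      = b * (2 * n + 1 + 2 * \<alpha> + 2 * t - 2 * t * (u + b + l)) + 1 - 2 * b"
    and down: "l * (2 * (n - 1) + 1 + 2 * \<alpha> + 2 * t - 2 * t * (b + l + l2))
      = b * (2 * n + 1 + 2 * \<alpha> + 2 * t - 2 * t * (u + b + l)) - 1 + 2 * l"
  shows "2 * (t * (t * b2 + 2 * b1)) = - 8 * t\<^sup>2 * b\<^sup>2 + 4 * t * (n + \<alpha>) * b - 4 * t * b\<^sup>2 * p - 2 * t * b * p
      + 2 * (n + \<alpha>) * b * p - b * (p\<^sup>2 - q\<^sup>2) - b * q"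
  using up down unfolding p q b2 b1 by algebra

text \<open>The equation for \<open>\<beta>\<close> from relations between neighbouring coefficients only. The factorisation gives
  \<open>X = - 4 t (b p) Y\<close>, and \<open>(b p)\<^sup>2\<close> is the bracket in the last factor of the right-hand side.\<close>
lemma ode_from_lattice:
  fixes t b u l u2 l2 n \<alpha> b1 b2 :: real
  assumes b1: "b1 = b * (l - u)" 
    and b2: "b2 = b1 * (l - u) + b * (l * (l2 - b) - u * (b - u2))"
    and up: "u * (2 * (n + 1) + 1 + 2 * \<alpha> + 2 * t - 2 * t * (u2 + u + b))
      = b * (2 * n + 1 + 2 * \<alpha> + 2 * t - 2 * t * (u + b + l)) + 1 - 2 * b"
    and down: "l * (2 * (n - 1) + 1 + 2 * \<alpha> + 2 * t - 2 * t * (b + l + l2))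
      = b * (2 * n + 1 + 2 * \<alpha> + 2 * t - 2 * t * (u + b + l)) - 1 + 2 * l"
    and int: "b * (2 * n + 1 + 2 * \<alpha> - 2 * t * (u + b)) * (2 * n - 1 + 2 * \<alpha> - 2 * t * (b + l))
      = (n - 2 * t * b) * (n + 2 * \<alpha> - 2 * t * b)"
  shows "(8 * t^2 * (t * b1 + b) * (t * b2 + 2 * b1)
        + 4 * t * (2 * t - 2 * n + 1 - 2 * \<alpha> + 4 * t * b) * (t * b1 + b)^2
        - 4 * t * (t * b1 + b) *
            (2 * n * \<alpha> + 2 * (n - 2 * \<alpha>) * (n - 2 * t * b) - 3 * (n - 2 * t * b)^2)
        + 4 * (n - 2 * t * b)^4
        - 4 * (n - 3 * \<alpha> + t) * (n - 2 * t * b)^3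
        + 4 * (n * (t - 3 * \<alpha>) - 2 * \<alpha> * (t - \<alpha>)) * (n - 2 * t * b)^2
        + 8 * n * \<alpha> * (t - \<alpha>) * (n - 2 * t * b))^2
      = (2 * t * (t * b2 + 2 * b1)
          + (2 * t - 2 * \<alpha> + 1 - 2 * (n - 2 * t * b)) * (t * b1 + b)
          + 3 * (n - 2 * t * b)^2
          - 2 * (n - 2 * \<alpha>) * (n - 2 * t * b)
          - 2 * n * \<alpha>)^2
        * (16 * t^2 * (b * (n - 2 * t * b) * (n + 2 * \<alpha> - 2 * t * b) + (t * b1 + b)^2))"
    (is "?X\<^sup>2 = ?Y\<^sup>2 * (16 * t^2 * ?\<Delta>)")
proof -
  define p q where "p = 2 * n + 2 * \<alpha> - t * (u + 2 * b + l)" and "q = 1 + t * (l - u)"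
  define Z where "Z = t * (t * b2 + 2 * b1)"
  have w: "t * b1 + b = b * q"
    by (simp add: q_def b1 algebra_simps)
  note Zeq = second_derivative_polynomial[OF p_def q_def b1 b2 up down, folded Z_def]
  have pq: "2 * n + 1 + 2 * \<alpha> - 2 * t * (u + b) = p + q" "2 * n - 1 + 2 * \<alpha> - 2 * t * (b + l) = p - q"
    by (simp_all add: p_def q_def algebra_simps)
  have I: "b * ((p + q) * (p - q)) - (n - 2 * t * b) * (n + 2 * \<alpha> - 2 * t * b) = 0"
    using int unfolding pq by (simp add: mult.assoc)
  have XZ: "8 * t^2 * (t * b1 + b) * (t * b2 + 2 * b1) = 8 * t * (t * b1 + b) * Z"
    and YZ: "2 * t * (t * b2 + 2 * b1) = 2 * Z"
    by (simp_all add: Z_def power2_eq_square)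
  have "?X + 4 * t * (b * p) * ?Y = 0"
    unfolding XZ YZ ode_factorisation[OF w Zeq refl] I by simp
  then have X: "?X = - (4 * t * (b * p) * ?Y)" by (simp only: eq_neg_iff_add_eq_0)
  have "?\<Delta> = b * ((n - 2 * t * b) * (n + 2 * \<alpha> - 2 * t * b)) + (b * q)\<^sup>2"
    unfolding w by simp
  also have "\<dots> = b * (b * ((p + q) * (p - q))) + (b * q)\<^sup>2"
    using I by simp
  also have "\<dots> = (b * p)\<^sup>2"
    by (simp add: algebra_simps power2_eq_square)
  finally have D: "?\<Delta> = (b * p)\<^sup>2" .
  have "(- (4 * t * s * y))\<^sup>2 = y\<^sup>2 * (16 * t\<^sup>2 * s\<^sup>2)" for s y :: real
    by (simp add: power_mult_distrib)
  then show ?thesis unfolding X D .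
qed

section \<open>Values for the undeformed weight\<close>

context deformed_jacobi_functional
begin

text \<open>Stated apart from the general formula, whose denominator vanishes for \<open>n = 1\<close> and \<open>\<alpha> = - 1 / 2\<close>.\<close>
lemma undeformed_b1:
  assumes "t = 0" "\<alpha> > -1"
  shows "b 1 = 1 / (3 + 2 * \<alpha>)"
  using string_equation[of 1] assms by (simp add: field_simps)

text \<open>At \<open>t = 0\<close> the string equation expresses \<open>b\<^sub>n\<close> by the partial sum before it, so the partial sums obey
  a first-order linear recursion. It is started at \<open>n = 2\<close>, from where on the denominators are positive.\<close>
lemma undeformed_sum_b:
  assumes "t = 0" "\<alpha> > -1"
  shows "n \<ge> 2 \<Longrightarrow> 2 * (\<Sum>j<n. b j) = real n * (real n - 1) / (2 * real n - 1 + 2 * \<alpha>)"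
proof (induction n rule: nat_induct_at_least)
  case base
  have "(\<Sum>j<2. b j) = b 1" by (simp add: numeral_2_eq_2)
  then show ?case using undeformed_b1[OF assms] by simp
next
  case (Suc n)
  have pos: "2 * real n - 1 + 2 * \<alpha> > 0" using Suc assms by simp
  have "b n = (real n - 2 * (\<Sum>j<n. b j)) / (2 * real n + 1 + 2 * \<alpha>)"
    using string_equation[of n] assms(1) pos by (simp add: field_simps)
  moreover have "r * (r - 1) / d + 2 * ((r - r * (r - 1) / d) / (d + 2)) = (r + 1) * r / (d + 2)"
    if "d > 0" for r d :: real
    using that by (simp add: divide_simps) (simp add: algebra_simps)
  note this[OF pos, of "real n"]
  ultimately show ?case
    unfolding sum.lessThan_Suc distrib_left Suc.IH by (simp add: algebra_simps)
qed

lemma undeformed_b: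
  assumes "t = 0" "\<alpha> > -1" "n \<ge> 2"
  shows "b n = real n * (real n + 2 * \<alpha>) / ((2 * real n - 1 + 2 * \<alpha>) * (2 * real n + 1 + 2 * \<alpha>))"
proof -
  have pos: "2 * real n - 1 + 2 * \<alpha> > 0" using assms by simp
  have "b n = (real n - 2 * (\<Sum>j<n. b j)) / (2 * real n + 1 + 2 * \<alpha>)"
    using string_equation[of n] assms(1) pos by (simp add: field_simps)
  then show ?thesis
    using pos unfolding undeformed_sum_b[OF assms]
    by (simp add: field_simps)
qed

end

text \<open>At an exceptional parameter the formula is a quotient of the form \<open>0/0\<close> with a common factor. It is
  enough that the reduced quotient \<open>R\<close> is continuous and that the denominator has finitely many zeros.\<close>
lemma quotient_value_continuous:
  assumes S: "finite S" and "\<alpha> > -1" and R: "isCont R \<alpha>"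
    and zero: "\<And>a. \<lbrakk>a > -1; den a = 0\<rbrakk> \<Longrightarrow> a \<in> S"
    and q: "\<And>a. \<lbrakk>a > -1; den a \<noteq> 0\<rbrakk> \<Longrightarrow> num a / den a = R a"
  shows "quotient_value num den \<alpha> (R \<alpha>)"
proof -
  have "eventually (\<lambda>a. a \<notin> S) (at \<alpha>)"
    using islimpt_finite[OF S, of \<alpha>] by (simp add: islimpt_iff_eventually)
  moreover have "eventually (\<lambda>a. a > -1) (at \<alpha>)"
    using order_tendstoD(1)[OF tendsto_ident_at assms(2)] .
  ultimately have "eventually (\<lambda>a. R a = num a / den a) (at \<alpha>)"
  proof eventually_elim
    case (elim a)
    then have "den a \<noteq> 0" using zero by blast
    with elim show ?case using q[of a] by simp
  qed
  with R have "((\<lambda>a. num a / den a) \<longlongrightarrow> R \<alpha>) (at \<alpha>)"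
    unfolding isCont_def by (rule Lim_transform_eventually)
  then show ?thesis using q[OF assms(2)] by (auto simp: quotient_value_def)
qed

lemma quotient_value_undeformed_b:
  assumes "\<alpha> > -1" "n \<ge> 1"
  shows "quotient_value (\<lambda>a. real n * (real n + 2 * a))
    (\<lambda>a. (2 * real n - 1 + 2 * a) * (2 * real n + 1 + 2 * a)) \<alpha> (op_coeff (weighted_integral \<alpha> 0) n)"
proof -
  interpret deformed_jacobi_functional "weighted_integral \<alpha> 0" \<alpha> 0
    by (rule weighted_integral_deformed_jacobi[OF assms(1)])
  show ?thesis
  proof (cases "n = 1")
    case True
    have "quotient_value (\<lambda>a. real n * (real n + 2 * a))
        (\<lambda>a. (2 * real n - 1 + 2 * a) * (2 * real n + 1 + 2 * a)) \<alpha> ((\<lambda>a. 1 / (3 + 2 * a)) \<alpha>)"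
      using assms by (intro quotient_value_continuous[of "{- 1 / 2}"] continuous_intros)
        (auto simp: True add.commute)
    then show ?thesis by (simp add: True undeformed_b1[unfolded One_nat_def] assms)
  next
    case False
    then have n: "n \<ge> 2" using assms by simp
    then have "2 * real n - 1 + 2 * \<alpha> > 0" using assms by simp
    then show ?thesis using undeformed_b[OF refl assms(1) n] by (simp add: quotient_value_def)
  qed
qed

text \<open>For \<open>n = 1\<close> the zeros of the denominator are \<open>- 1 / 2\<close> and \<open>1 / 2\<close>, for \<open>n = 2\<close> only \<open>- 1 / 2\<close>, and for
  \<open>n \<ge> 3\<close> it has none in the range of \<open>\<alpha>\<close>.\<close>
lemma quotient_value_undeformed_b':
  assumes "\<alpha> > -1" "n \<ge> 1"
  defines "b \<equiv> op_coeff (weighted_integral \<alpha> 0)"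
  shows "quotient_value (\<lambda>a. 4 * real n * (real n + a) * (real n + 2 * a) * (1 - 4 * a^2))
    (\<lambda>a. (2 * real n - 1 + 2 * a)^2 * (2 * real n + 1 + 2 * a)^2
        * (2 * real n - 3 + 2 * a) * (2 * real n + 3 + 2 * a)) \<alpha> (b n * (b (n - 1) - b (Suc n)))"
    (is "quotient_value ?num ?den _ _")
proof -
  interpret deformed_jacobi_functional "weighted_integral \<alpha> 0" \<alpha> 0
    by (rule weighted_integral_deformed_jacobi[OF assms(1)])
  note b1 = undeformed_b1[OF refl assms(1), folded b_def]
  note bn = undeformed_b[OF refl assms(1), folded b_def]
  consider "n = 1" | "n = 2" | "n \<ge> 3" using assms(2) by linarith
  then show ?thesis
  proof cases
    case 1
    let ?R = "\<lambda>a::real. - (4 * (1 + a)) / ((3 + 2 * a)\<^sup>2 * (5 + 2 * a))"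
    have "quotient_value ?num ?den \<alpha> (?R \<alpha>)"
    proof (rule quotient_value_continuous[of "{- 1 / 2, 1 / 2}"])
      show "a \<in> {- 1 / 2, 1 / 2}" if "a > -1" "?den a = 0" for a
        using that by (auto simp: 1)
      show "?num a / ?den a = ?R a" if "a > -1" "?den a \<noteq> 0" for a
        using that by (subst frac_eq_eq) (simp_all add: 1, algebra)
    qed (use assms in \<open>auto intro!: continuous_intros\<close>)
    also have "?R \<alpha> = b n * (b (n - 1) - b (Suc n))"
    proof -
      have "b 2 = 2 * (2 + 2 * \<alpha>) / ((3 + 2 * \<alpha>) * (5 + 2 * \<alpha>))" using bn[of 2] by simp
      moreover have "b 0 = 0" by (simp add: b_def)
      ultimately show ?thesis
        using assms(1) b1 by (simp add: 1 numeral_2_eq_2 power2_eq_square) (simp add: field_simps, simp add: minus_divide_left)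
    qed
    finally show ?thesis .
  next
    case 2
    let ?R = "\<lambda>a::real. 8 * (2 + a) * (2 + 2 * a) * (1 - 2 * a) / ((3 + 2 * a)\<^sup>2 * (5 + 2 * a)\<^sup>2 * (7 + 2 * a))"
    have "quotient_value ?num ?den \<alpha> (?R \<alpha>)"
    proof (rule quotient_value_continuous[of "{- 1 / 2}"])
      show "a \<in> {- 1 / 2}" if "a > -1" "?den a = 0" for a
        using that by (auto simp: 2)
      show "?num a / ?den a = ?R a" if "a > -1" "?den a \<noteq> 0" for a
        using that by (subst frac_eq_eq) (simp_all add: 2, algebra)
    qed (use assms in \<open>auto intro!: continuous_intros\<close>)
    also have "?R \<alpha> = b n * (b (n - 1) - b (Suc n))"
    proof -
      have "b 2 = 2 * (2 + 2 * \<alpha>) / ((3 + 2 * \<alpha>) * (5 + 2 * \<alpha>))" using bn[of 2] by simp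
      moreover have "b 3 = 3 * (3 + 2 * \<alpha>) / ((5 + 2 * \<alpha>) * (7 + 2 * \<alpha>))" using bn[of 3] by simp
      moreover have "1 / (3 + 2 * \<alpha>) - 3 * (3 + 2 * \<alpha>) / ((5 + 2 * \<alpha>) * (7 + 2 * \<alpha>))
          = 4 * (1 - 2 * \<alpha>) * (2 + \<alpha>) / ((3 + 2 * \<alpha>) * ((5 + 2 * \<alpha>) * (7 + 2 * \<alpha>)))"
        using assms(1) by (subst diff_frac_eq, simp, simp, subst frac_eq_eq) (simp_all, algebra)
      ultimately have "b 2 * (b 1 - b 3) = 2 * (2 + 2 * \<alpha>) * (4 * (1 - 2 * \<alpha>) * (2 + \<alpha>))
          / ((3 + 2 * \<alpha>) * (5 + 2 * \<alpha>) * ((3 + 2 * \<alpha>) * ((5 + 2 * \<alpha>) * (7 + 2 * \<alpha>))))"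
        by (simp only: b1 times_divide_times_eq)
      also have "\<dots> = ?R \<alpha>"
        by (rule arg_cong2[of _ _ _ _ "(/)"]) algebra+
      finally show ?thesis
        by (simp add: 2 numeral_2_eq_2 numeral_3_eq_3)
    qed
    finally show ?thesis .
  next
    case 3
    \<comment> \<open>In the variable \<open>d\<close> the denominator factors as \<open>(d - 1)\<^sup>2 (d + 1)\<^sup>2 (d - 3) (d + 3)\<close>.\<close>
    define d where "d = 2 * real n + 2 * \<alpha>"
    have d: "d > 3" using 3 assms(1) by (simp add: d_def)
    have \<alpha>: "\<alpha> = (d - 2 * real n) / 2" by (simp add: d_def)
    have "b n = real n * (d - real n) / ((d - 1) * (d + 1))"
      using bn[of n] 3 by (simp add: d_def algebra_simps)
    moreover have "b (n - 1) = (real n - 1) * (d - real n - 1) / ((d - 3) * (d - 1))"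
      using bn[of "n - 1"] 3 by (simp add: d_def of_nat_diff algebra_simps)
    moreover have "b (Suc n) = (real n + 1) * (d - real n + 1) / ((d + 1) * (d + 3))"
      using bn[of "Suc n"] 3 by (simp add: d_def algebra_simps)
    moreover have "(real n - 1) * (d - real n - 1) / ((d - 3) * (d - 1)) - (real n + 1) * (d - real n + 1) / ((d + 1) * (d + 3))
        = 2 * d * (1 - (d - 2 * real n)\<^sup>2) / ((d - 1) * (d + 1) * (d - 3) * (d + 3))"
      using d by (subst diff_frac_eq, simp, simp, subst frac_eq_eq) (simp_all, algebra)
    moreover have "?num \<alpha> = real n * (d - real n) * (2 * d * (1 - (d - 2 * real n)\<^sup>2))"
      unfolding \<alpha> by (simp add: field_simps power2_eq_square)
    moreover have den: "?den \<alpha> = (d - 1) * (d + 1) * ((d - 1) * (d + 1) * (d - 3) * (d + 3))"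
      unfolding \<alpha> by (simp add: field_simps power2_eq_square)
    ultimately have "b n * (b (n - 1) - b (Suc n)) = ?num \<alpha> / ?den \<alpha>"
      by (simp only: times_divide_times_eq)
    moreover have "?den \<alpha> \<noteq> 0" unfolding den using d by simp
    ultimately show ?thesis by (simp only: quotient_value_def if_True simp_thms)
  qed
qed

section \<open>The differential equation and its initial values\<close>

theorem theorem4p4:
  fixes \<alpha> :: real and n :: nat and \<beta> \<beta>' \<beta>'' :: "real \<Rightarrow> real"
  assumes "\<alpha> > -1" and "n \<ge> 1"
  defines "\<beta> \<equiv> rec_coeff \<alpha> n"
    and "\<beta>' \<equiv> deriv \<beta>"
    and "\<beta>'' \<equiv> deriv \<beta>'"
  shows "(\<forall>t::real. \<beta> differentiable (at t) \<and> \<beta>' differentiable (at t) \<and>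
      (8 * t^2 * (t * \<beta>' t + \<beta> t) * (t * \<beta>'' t + 2 * \<beta>' t)
        + 4 * t * (2 * t - 2 * real n + 1 - 2 * \<alpha> + 4 * t * \<beta> t) * (t * \<beta>' t + \<beta> t)^2
        - 4 * t * (t * \<beta>' t + \<beta> t) *
            (2 * real n * \<alpha> + 2 * (real n - 2 * \<alpha>) * (real n - 2 * t * \<beta> t) - 3 * (real n - 2 * t * \<beta> t)^2)
        + 4 * (real n - 2 * t * \<beta> t)^4
        - 4 * (real n - 3 * \<alpha> + t) * (real n - 2 * t * \<beta> t)^3
        + 4 * (real n * (t - 3 * \<alpha>) - 2 * \<alpha> * (t - \<alpha>)) * (real n - 2 * t * \<beta> t)^2
        + 8 * real n * \<alpha> * (t - \<alpha>) * (real n - 2 * t * \<beta> t))^2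
      = (2 * t * (t * \<beta>'' t + 2 * \<beta>' t)
          + (2 * t - 2 * \<alpha> + 1 - 2 * (real n - 2 * t * \<beta> t)) * (t * \<beta>' t + \<beta> t)
          + 3 * (real n - 2 * t * \<beta> t)^2
          - 2 * (real n - 2 * \<alpha>) * (real n - 2 * t * \<beta> t)
          - 2 * real n * \<alpha>)^2
        * (16 * t^2 * (\<beta> t * (real n - 2 * t * \<beta> t) * (real n + 2 * \<alpha> - 2 * t * \<beta> t)
            + (t * \<beta>' t + \<beta> t)^2)))
    \<and> quotient_value
        (\<lambda>a. real n * (real n + 2 * a))
        (\<lambda>a. (2 * real n - 1 + 2 * a) * (2 * real n + 1 + 2 * a))
        \<alpha> (\<beta> 0)
    \<and> quotient_value
        (\<lambda>a. 4 * real n * (real n + a) * (real n + 2 * a) * (1 - 4 * a^2))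
        (\<lambda>a. (2 * real n - 1 + 2 * a)^2 * (2 * real n + 1 + 2 * a)^2
            * (2 * real n - 3 + 2 * a) * (2 * real n + 3 + 2 * a))
        \<alpha> (\<beta>' 0)"
proof -
  let ?L = "weighted_integral \<alpha>"
  let ?b = "\<lambda>m t. op_coeff (?L t) m"
  note \<alpha> = assms(1)
  have lattice: "deformed_jacobi_functional (?L t) \<alpha> t" for t
    by (rule weighted_integral_deformed_jacobi[OF \<alpha>])
  have \<beta>: "\<beta> = ?b n"
    by (simp add: assms(3) rec_coeff_eq[OF \<alpha>] fun_eq_iff)
  have d1: "(?b m has_real_derivative ?b m t * (?b (m - 1) t - ?b (Suc m) t)) (at t)" for m t
    by (rule volterra[OF \<alpha>])
  have \<beta>': "\<beta>' = (\<lambda>t. ?b n t * (?b (n - 1) t - ?b (Suc n) t))"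
    unfolding assms(4) \<beta> fun_eq_iff by (blast intro: DERIV_imp_deriv d1)
  \<comment> \<open>For \<open>n = 1\<close> the index \<open>n - 2\<close> is truncated, but the corresponding coefficient is multiplied by
    the coefficient with index \<open>n - 1 = 0\<close>, which is zero.\<close>
  have d2: "(\<beta>' has_real_derivative \<beta>' t * (?b (n - 1) t - ?b (Suc n) t)
      + ?b n t * (?b (n - 1) t * (?b (n - 2) t - ?b n t) - ?b (Suc n) t * (?b n t - ?b (Suc (Suc n)) t))) (at t)" for t
    unfolding \<beta>'
    by (rule DERIV_cong[OF DERIV_mult[OF d1 DERIV_diff[OF d1 d1]]])
       (use assms(2) in \<open>simp add: numeral_2_eq_2\<close>)
  have \<beta>'': "\<beta>'' t = \<beta>' t * (?b (n - 1) t - ?b (Suc n) t)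
      + \<beta> t * (?b (n - 1) t * (?b (n - 2) t - \<beta> t) - ?b (Suc n) t * (\<beta> t - ?b (Suc (Suc n)) t))" for t
    unfolding assms(5) DERIV_imp_deriv[OF d2] by (simp only: \<beta>)
  have diff: "\<beta> differentiable (at t)" "\<beta>' differentiable (at t)" for t
    using d1 d2 unfolding \<beta> real_differentiable_def by blast+
  have eqs: "\<beta>' t = \<beta> t * (?b (n - 1) t - ?b (Suc n) t)"
    "?b (Suc n) t * (2 * (real n + 1) + 1 + 2 * \<alpha> + 2 * t - 2 * t * (?b (Suc (Suc n)) t + ?b (Suc n) t + \<beta> t))
      = \<beta> t * (2 * real n + 1 + 2 * \<alpha> + 2 * t - 2 * t * (?b (Suc n) t + \<beta> t + ?b (n - 1) t)) + 1 - 2 * \<beta> t"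
    "?b (n - 1) t * (2 * (real n - 1) + 1 + 2 * \<alpha> + 2 * t - 2 * t * (\<beta> t + ?b (n - 1) t + ?b (n - 2) t))
      = \<beta> t * (2 * real n + 1 + 2 * \<alpha> + 2 * t - 2 * t * (?b (Suc n) t + \<beta> t + ?b (n - 1) t)) - 1 + 2 * ?b (n - 1) t"
    "\<beta> t * (2 * real n + 1 + 2 * \<alpha> - 2 * t * (?b (Suc n) t + \<beta> t)) * (2 * real n - 1 + 2 * \<alpha> - 2 * t * (\<beta> t + ?b (n - 1) t))
      = (real n - 2 * t * \<beta> t) * (real n + 2 * \<alpha> - 2 * t * \<beta> t)" for t
  proof -
    interpret deformed_jacobi_functional "?L t" \<alpha> t by (rule lattice)
    obtain m where m: "n = Suc m" using assms(2) by (cases n) auto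
    show "\<beta>' t = \<beta> t * (?b (n - 1) t - ?b (Suc n) t)" by (simp add: \<beta> \<beta>')
    show "?b (Suc n) t * (2 * (real n + 1) + 1 + 2 * \<alpha> + 2 * t - 2 * t * (?b (Suc (Suc n)) t + ?b (Suc n) t + \<beta> t))
      = \<beta> t * (2 * real n + 1 + 2 * \<alpha> + 2 * t - 2 * t * (?b (Suc n) t + \<beta> t + ?b (n - 1) t)) + 1 - 2 * \<beta> t"
      using string_equation[of n] string_equation[of "Suc n"] by (simp add: \<beta> add_ac)
    show "?b (n - 1) t * (2 * (real n - 1) + 1 + 2 * \<alpha> + 2 * t - 2 * t * (\<beta> t + ?b (n - 1) t + ?b (n - 2) t))
      = \<beta> t * (2 * real n + 1 + 2 * \<alpha> + 2 * t - 2 * t * (?b (Suc n) t + \<beta> t + ?b (n - 1) t)) - 1 + 2 * ?b (n - 1) t"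
      using string_equation[of m] string_equation[of "Suc m"] by (simp add: \<beta> m numeral_2_eq_2)
    show "\<beta> t * (2 * real n + 1 + 2 * \<alpha> - 2 * t * (?b (Suc n) t + \<beta> t)) * (2 * real n - 1 + 2 * \<alpha> - 2 * t * (\<beta> t + ?b (n - 1) t))
      = (real n - 2 * t * \<beta> t) * (real n + 2 * \<alpha> - 2 * t * \<beta> t)"
      unfolding \<beta> by (rule first_integral)
  qed
  note ode = ode_from_lattice[OF eqs(1) \<beta>'' eqs(2-4)]
  have \<beta>0: "\<beta> 0 = ?b n 0" "\<beta>' 0 = ?b n 0 * (?b (n - 1) 0 - ?b (Suc n) 0)"
    by (simp_all add: \<beta> \<beta>')
  show ?thesis
    unfolding \<beta>0
    by (intro conjI allI diff ode quotient_value_undeformed_b quotient_value_undeformed_b' assms)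
qed

end
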